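(* Let $d\ge 2$, let $V=X\sqcup Y$ be a finite vertex set with a given bipartition, and let $\mathbf{p}_i\in\mathbb{R}^{d-1}$ ($i\in V$) be positions for the vertices. Then, restricted to subsets of the edge set $\{\{i,j\}: i\in X, j\in Y\}$ (bipartite graphs with that bipartition), the following two matroids coincide: (1) the $d$-dimensional bar-and-joint rigidity matroid of the points $(\mathbf{p}_i,0)$ for $i\in X$ and $(\mathbf{p}_j,1)$ for $j\in Y$; (2) the $d$-dimensional hyperconnectivity matroid of the points $(\mathbf{p}_i,1)$, $i\in V$.
   Context: For points $\mathbf{q}_v\in\mathbb{R}^d$ ($v\in V$), matrices have rows indexed by unordered pairs $\{i,j\}$ of vertices and $|V|d$ columns grouped into blocks of size $d$, one per vertex; row $\{i,j\}$ is zero outside blocks $i$ and $j$. Bar-and-joint rigidity matrix: $\mathbf{q}_i-\mathbf{q}_j$ in block $i$, $\mathbf{q}_j-\mathbf{q}_i$ in block $j$. Hyperconnectivity matrix: $\mathbf{q}_j$ in block $i$, $-\mathbf{q}_i$ in block $j$ (for a fixed ordering $i<j$; the sign convention does not affect the matroid). The corresponding matroid is the linear matroid of the rows, with ground set the pairs. *)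

theory Defs
  imports "HOL-Analysis.Analysis"
begin

record 'e matroid =
  ground :: "'e set"
  indep :: "'e set set"

text \<open>The linear matroid of an indexed family of vectors (the rows of a matrix). Injectivity makes
  two indices carrying the same vector parallel, as they are in the matroid of the rows.\<close>

definition linear_matroid :: "'e set \<Rightarrow> ('e \<Rightarrow> 'a::real_vector) \<Rightarrow> 'e matroid" where
  "linear_matroid E r = \<lparr>ground = E, indep = {S. S \<subseteq> E \<and> inj_on r S \<and> independent (r ` S)}\<rparr>"

definition matroid_restrict :: "'e matroid \<Rightarrow> 'e set \<Rightarrow> 'e matroid" where
  "matroid_restrict M T = \<lparr>ground = ground M \<inter> T, indep = {S \<in> indep M. S \<subseteq> T}\<rparr>"

definition vertex_pairs :: "'v set set" where
  "vertex_pairs = {{i, j} | i j. i \<noteq> j}"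

definition bipartite_pairs :: "'v set \<Rightarrow> 'v set \<Rightarrow> 'v set set" where
  "bipartite_pairs X Y = {{i, j} | i j. i \<in> X \<and> j \<in> Y}"

text \<open>The vertex set is the finite type \<^typ>\<open>'v\<close>. A row is an element of \<^typ>\<open>'a ^ 'v\<close>, with one
  block in \<^typ>\<open>'a\<close> (Euclidean space of dimension \<open>d\<close>) per vertex. For a pair \<open>e = {i, j}\<close> with
  \<open>i < j\<close> we have \<open>i = Min e\<close> and \<open>j = Max e\<close>.\<close>

definition rigidity_row ::
    "('v::{finite,linorder} \<Rightarrow> 'a::euclidean_space) \<Rightarrow> 'v set \<Rightarrow> ('a, 'v) vec" where
  "rigidity_row q e =
     (let i = Min e; j = Max e
      in \<chi> v. if v = i then q i - q j else if v = j then q j - q i else 0)"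

definition hyperconnectivity_row ::
    "('v::{finite,linorder} \<Rightarrow> 'a::euclidean_space) \<Rightarrow> 'v set \<Rightarrow> ('a, 'v) vec" where
  "hyperconnectivity_row q e =
     (let i = Min e; j = Max e
      in \<chi> v. if v = i then q j else if v = j then - q i else 0)"

definition rigidity_matroid ::
    "('v::{finite,linorder} \<Rightarrow> 'a::euclidean_space) \<Rightarrow> 'v set matroid" where
  "rigidity_matroid q = linear_matroid vertex_pairs (rigidity_row q)"

definition hyperconnectivity_matroid ::
    "('v::{finite,linorder} \<Rightarrow> 'a::euclidean_space) \<Rightarrow> 'v set matroid" where
  "hyperconnectivity_matroid q = linear_matroid vertex_pairs (hyperconnectivity_row q)"

lemma rigidity_row_pair:
  "i \<noteq> j \<Longrightarrow> rigidity_row q {i, j} =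
     (\<chi> v. if v = i then q i - q j else if v = j then q j - q i else 0)"
  by (cases "i < j") (auto simp: rigidity_row_def vec_eq_iff min_def max_def)

lemma hyperconnectivity_row_pair:
  "i < j \<Longrightarrow> hyperconnectivity_row q {i, j} =
     (\<chi> v. if v = i then q j else if v = j then - q i else 0)"
  by (auto simp: hyperconnectivity_row_def min_def max_def)

end

theory Submission
  imports Defs
begin

text \<open>The rigidity row of \<open>{i, j}\<close> with \<open>i \<in> X\<close>, \<open>j \<in> Y\<close> has blocks \<open>(p i - p j, -1)\<close> at \<open>i\<close> and
  \<open>(p j - p i, 1)\<close> at \<open>j\<close>. The invertible shears \<open>(a, t) \<mapsto> (a + t p i, t)\<close> on the blocks of \<open>X\<close> and
  \<open>(a, t) \<mapsto> (t p j - a, t)\<close> on the blocks of \<open>Y\<close> turn them into \<open>-(p j, 1)\<close> and \<open>(p i, 1)\<close>, which up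
  to sign is the hyperconnectivity row of \<open>{i, j}\<close>.\<close>

text \<open>Coefficients indexed by \<open>S\<close> rather than by vectors treat injectivity and
  independence as one condition and can later be rescaled edge by edge. For injective
  \<open>r\<close>, relations over \<open>S\<close> and over the image correspond by
  reindexing.\<close>

lemma inj_on_independent_image_iff:
  fixes r :: "'e \<Rightarrow> 'a::real_vector"
  assumes "finite S"
  shows "inj_on r S \<and> independent (r ` S) \<longleftrightarrow>
    (\<forall>c. (\<Sum>e\<in>S. c e *\<^sub>R r e) = 0 \<longrightarrow> (\<forall>e\<in>S. c e = 0))" (is "?L \<longleftrightarrow> ?R")
proof
  assume L: ?L
  show ?R
  proof (intro allI impI ballI)
    fix c e assume c: "(\<Sum>e\<in>S. c e *\<^sub>R r e) = 0" and e: "e \<in> S"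
    have "(\<Sum>v\<in>r ` S. c (inv_into S r v) *\<^sub>R v) = 0"
      using L c by (simp add: sum.reindex)
    then have "c (inv_into S r (r e)) = 0"
      using L e assms independentD[of "r ` S" "r ` S" "\<lambda>v. c (inv_into S r v)" "r e"] by blast
    then show "c e = 0"
      using L e by simp
  qed
next
  assume R: ?R
  have inj: "inj_on r S"
  proof (rule inj_onI, rule ccontr)
    fix e f assume ef: "e \<in> S" "f \<in> S" "r e = r f" "e \<noteq> f"
    \<comment> \<open>Coefficient 1 at \<open>e\<close> and -1 at \<open>f\<close>: two indices with
      the same vector already give a nontrivial relation.\<close>
    let ?c = "\<lambda>x. (if x = e then 1 else 0) - (if x = f then 1 else 0 :: real)"
    have "(\<Sum>x\<in>S. ?c x *\<^sub>R r x) =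
        (\<Sum>x\<in>S. if x = e then r x else 0) - (\<Sum>x\<in>S. if x = f then r x else 0)"
      unfolding sum_subtractf[symmetric] by (rule sum.cong) auto
    also have "\<dots> = 0"
      using ef assms by simp
    finally have "?c e = 0"
      using R[rule_format, of ?c, OF _ ef(1)] by simp
    then show False
      using ef(4) by simp
  qed
  have "u v = 0" if "(\<Sum>v\<in>r ` S. u v *\<^sub>R v) = 0" "v \<in> r ` S" for u v
    using that R[rule_format, of "u \<circ> r"] inj by (auto simp: sum.reindex)
  then have "independent (r ` S)"
    using assms by (auto simp: dependent_finite)
  with inj show ?L ..
qed

text \<open>An injective linear map preserves and reflects relations, and multiplying coefficients
  pointwise by the nonzero \<open>s\<close> is a bijection on coefficient families that keeps the
  zero family zero. The factor may differ from edge to edge, as the signs below do.\<close>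

lemma inj_on_independent_image_transfer:
  fixes r :: "'e \<Rightarrow> 'a::real_vector" and r' :: "'e \<Rightarrow> 'b::real_vector"
  assumes "finite S" and T: "linear T" "inj T"
    and s: "\<And>e. e \<in> S \<Longrightarrow> s e \<noteq> 0" and eq: "\<And>e. e \<in> S \<Longrightarrow> T (r e) = s e *\<^sub>R r' e"
  shows "inj_on r S \<and> independent (r ` S) \<longleftrightarrow> inj_on r' S \<and> independent (r' ` S)"
proof -
  have sum: "(\<Sum>e\<in>S. c e *\<^sub>R r e) = 0 \<longleftrightarrow> (\<Sum>e\<in>S. (c e * s e) *\<^sub>R r' e) = 0" for c
  proof -
    have "T (\<Sum>e\<in>S. c e *\<^sub>R r e) = (\<Sum>e\<in>S. (c e * s e) *\<^sub>R r' e)"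
      using T(1) by (simp add: linear_sum linear_cmul eq)
    then show ?thesis
      using T by (metis linear_injective_0 linear_0)
  qed
  have "(\<forall>c. (\<Sum>e\<in>S. c e *\<^sub>R r e) = 0 \<longrightarrow> (\<forall>e\<in>S. c e = 0)) \<longleftrightarrow>
      (\<forall>c. (\<Sum>e\<in>S. c e *\<^sub>R r' e) = 0 \<longrightarrow> (\<forall>e\<in>S. c e = 0))" (is "?A \<longleftrightarrow> ?B")
  proof
    assume A: ?A
    show ?B
    proof (intro allI impI)
      fix c assume c: "(\<Sum>e\<in>S. c e *\<^sub>R r' e) = 0"
      have "(\<Sum>e\<in>S. (c e / s e * s e) *\<^sub>R r' e) = (\<Sum>e\<in>S. c e *\<^sub>R r' e)"
        by (rule sum.cong) (auto simp: s)
      then have "\<forall>e\<in>S. c e / s e = 0"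
        using A[rule_format, of "\<lambda>e. c e / s e"] c sum[of "\<lambda>e. c e / s e"] by simp
      then show "\<forall>e\<in>S. c e = 0"
        using s by auto
    qed
  next
    assume B: ?B
    show ?A
    proof (intro allI impI)
      fix c assume "(\<Sum>e\<in>S. c e *\<^sub>R r e) = 0"
      then have "\<forall>e\<in>S. c e * s e = 0"
        using B[rule_format, of "\<lambda>e. c e * s e"] sum[of c] by simp
      then show "\<forall>e\<in>S. c e = 0"
        using s by auto
    qed
  qed
  then show ?thesis
    using \<open>finite S\<close> by (simp add: inj_on_independent_image_iff)
qed

text \<open>The sign flip of the first component outside \<open>X\<close> is what yields
  \<open>(p i, 1)\<close> there instead of \<open>(- p i, 1)\<close>.\<close>

definition block_shear ::
    "'v set \<Rightarrow> ('v \<Rightarrow> 'a::real_vector) \<Rightarrow> ('a \<times> real, 'v::finite) vec \<Rightarrow> ('a \<times> real, 'v) vec" where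
  "block_shear X p w =
     (\<chi> v. if v \<in> X then (fst (w $ v) + snd (w $ v) *\<^sub>R p v, snd (w $ v))
            else (snd (w $ v) *\<^sub>R p v - fst (w $ v), snd (w $ v)))"

lemma linear_block_shear: "linear (block_shear X p)"
  by (rule linearI) (auto simp: block_shear_def vec_eq_iff algebra_simps)

lemma inj_block_shear: "inj (block_shear X p)"
proof (rule injI)
  fix w w' assume eq: "block_shear X p w = block_shear X p w'"
  have "w $ v = w' $ v" for v
  proof (rule prod_eqI)
    have v: "block_shear X p w $ v = block_shear X p w' $ v"
      by (simp only: eq)
    \<comment> \<open>The last coordinate is unchanged by the map; once it is known to agree, the
      multiples of \<open>p v\<close> cancel.\<close>
    show snd: "snd (w $ v) = snd (w' $ v)"
      using v by (cases "v \<in> X") (simp_all add: block_shear_def)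
    show "fst (w $ v) = fst (w' $ v)"
      using v snd by (cases "v \<in> X") (simp_all add: block_shear_def)
  qed
  then show "w = w'"
    by (simp add: vec_eq_iff)
qed

text \<open>The rigidity row is symmetric in \<open>i\<close> and \<open>j\<close>, whereas the
  hyperconnectivity row is oriented from the smaller vertex to the larger. Hence the sign records
  whether the endpoint in \<open>X\<close> comes first.\<close>

lemma block_shear_rigidity_row:
  fixes p :: "'v::{finite,linorder} \<Rightarrow> 'a::euclidean_space"
  assumes "i \<in> X" and "j \<notin> X"
  shows "block_shear X p
      (rigidity_row (\<lambda>i. if i \<in> X then (p i, 0::real) else (p i, 1)) {i, j}) =
    (if i < j then - 1 else 1) *\<^sub>R hyperconnectivity_row (\<lambda>i. (p i, 1::real)) {i, j}"
proof (cases "i < j")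
  case True
  with assms show ?thesis
    by (auto simp: rigidity_row_pair hyperconnectivity_row_pair block_shear_def vec_eq_iff
        zero_prod_def)
next
  case False
  with assms have "j < i" by (metis linorder_neqE)
  with assms show ?thesis
    by (auto simp: rigidity_row_pair hyperconnectivity_row_pair[of j i] insert_commute[of i j]
        block_shear_def vec_eq_iff zero_prod_def)
qed

theorem theorem4p4:
  fixes X Y :: "'v::{finite,linorder} set"
    and p :: "'v \<Rightarrow> real ^ 'n"
  assumes "X \<union> Y = UNIV" and "X \<inter> Y = {}"
  shows "matroid_restrict
           (rigidity_matroid (\<lambda>i. if i \<in> X then (p i, 0::real) else (p i, 1)))
           (bipartite_pairs X Y) =
         matroid_restrict
           (hyperconnectivity_matroid (\<lambda>i. (p i, 1::real)))
           (bipartite_pairs X Y)"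
proof -
  let ?r = "rigidity_row (\<lambda>i. if i \<in> X then (p i, 0::real) else (p i, 1))"
  let ?h = "hyperconnectivity_row (\<lambda>i. (p i, 1::real))"
  have "\<exists>s. s \<noteq> 0 \<and> block_shear X p (?r e) = s *\<^sub>R ?h e" if "e \<in> bipartite_pairs X Y" for e
  proof -
    obtain i j where ij: "e = {i, j}" "i \<in> X" "j \<in> Y"
      using \<open>e \<in> bipartite_pairs X Y\<close> by (auto simp: bipartite_pairs_def)
    then have "j \<notin> X" using assms(2) by blast
    from block_shear_rigidity_row[OF ij(2) this, of p] show ?thesis
      unfolding ij(1) by (intro exI[of _ "if i < j then - 1 else 1"]) simp
  qed
  \<comment> \<open>One sign per edge is fixed for all bipartite pairs at once, so the same
    \<open>s\<close> serves every \<open>S\<close>.\<close>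
  then obtain s
    where s: "\<forall>e\<in>bipartite_pairs X Y. s e \<noteq> 0 \<and> block_shear X p (?r e) = s e *\<^sub>R ?h e"
    using bchoice[of "bipartite_pairs X Y" "\<lambda>e s. s \<noteq> 0 \<and> block_shear X p (?r e) = s *\<^sub>R ?h e"]
    by blast
  have iff: "inj_on ?r S \<and> independent (?r ` S) \<longleftrightarrow> inj_on ?h S \<and> independent (?h ` S)"
    if "S \<subseteq> bipartite_pairs X Y" for S
  proof (rule inj_on_independent_image_transfer[OF _ linear_block_shear inj_block_shear])
    fix e assume "e \<in> S"
    with that s show "s e \<noteq> 0" and "block_shear X p (?r e) = s e *\<^sub>R ?h e"
      by blast+
  qed simp
  \<comment> \<open>Both ground sets are \<open>vertex_pairs\<close> cut down to the bipartite
    pairs, so only the independent sets have to be compared.\<close>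
  show ?thesis
    unfolding matroid_restrict_def rigidity_matroid_def hyperconnectivity_matroid_def
      linear_matroid_def
    using iff by (auto simp only: matroid.simps mem_Collect_eq)
qed

end
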